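(* There exist a category $\mathcal C$, a collection $\Gamma$ of morphisms of $\mathcal C$, a functor $\mathcal C\to\mathcal D$ that is the identity on objects, and a faithful functor $\mathcal D\to\mathcal C[\Gamma^{-1}]$ such that the composite $\mathcal C\to\mathcal D\to\mathcal C[\Gamma^{-1}]$ is the localization functor, and such that, for every center $\{[N_i,d_i]\}_{i\in I}$ in $\mathcal C$, the functor $\mathcal C\to\mathcal D$ is not isomorphic (as a functor out of $\mathcal C$) to the canonical functor $\mathcal C\to\mathcal C[\{(d_i)^{-1}\circ N_i\}_{i\in I}]$.
   Context: A sieve in $\mathcal C$ is a collection of morphisms stable under precomposition; a sieve over an object $Y$ is a sieve all of whose morphisms have codomain $Y$. Localization. For a collection $\Sigma$ of morphisms of $\mathcal C$, let $\mathcal G$ be the directed graph whose vertices are the objects of $\mathcal C$ and whose directed lines are: a line $a:dom(a)\to cod(a)$ for each morphism $a$ of $\mathcal C$, and a line $l_d:cod(d)\to dom(d)$ for each $d\in\Sigma$. A $\Sigma$-sequence is a finite, possibly empty, path of composable directed lines of $\mathcal G$ (an empty sequence is given by an object). Two $\Sigma$-sequences with the same domain and codomain are equivalent if they are related by a chain of replacements of consecutive parts (written in order of traversal): $X\xrightarrow{a}Y\xrightarrow{a'}Z \leftrightsquigarrow X\xrightarrow{a'\circ a}Z$ for $a,a'\in Mor\,\mathcal C$; $l_d,d\leftrightsquigarrow$ empty and $d,l_d\leftrightsquigarrow$ empty for $d\in\Sigma$; $Id_X\leftrightsquigarrow$ empty sequence at $X$. The class of $s$ is denoted $[s]$; a $\Sigma$-fraction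 is such a class. The localization $\mathcal C[\Sigma^{-1}]$ has the objects of $\mathcal C$ as objects and $\Sigma$-fractions as morphisms (composed by concatenation); the localization functor $\mathcal C\to\mathcal C[\Sigma^{-1}]$ is the identity on objects and $a\mapsto[a]$ on morphisms. Dilatation. A center in $\mathcal C$ is a collection $\{[N_i,d_i]\}_{i\in I}$ where each $d_i$ is a morphism of $\mathcal C$ and $N_i$ is a sieve over $cod(d_i)$. Put $\Sigma=\{d_i\}_{i\in I}$. A $\{[N_i,d_i]\}_{i\in I}$-fraction is a $\Sigma$-fraction having a representative of the form $X_1\xrightarrow{n_1}Y_1\xrightarrow{l_{d_{i_1}}}X_2\xrightarrow{n_2}Y_2\xrightarrow{l_{d_{i_2}}}X_3\cdots X_k\xrightarrow{n_k}Y_k\xrightarrow{l_{d_{i_k}}}X_{k+1}\xrightarrow{a}X_{k+2}$ with $a\in Mor\,\mathcal C$, $k\ge 0$, $i_j\in I$ and $n_j\in N_{i_j}$ for all $j$. The dilatation $\mathcal C[\{(d_i)^{-1}\circ N_i\}_{i\in I}]$ is the category with the same objects as $\mathcal C$ and with $\{[N_i,d_i]\}_{i\in I}$-fractions as morphisms. The canonical functor $\mathcal C\to\mathcal C[\{(d_i)^{-1}\circ N_i\}_{i\in I}]$ is the identity on objects and $a\mapsto[a]$ on morphisms. Two functors $F_1:\mathcal C\to\mathcal D_1$, $F_2:\mathcal C\to\mathcal D_2$ out of $\mathcal C$ are isomorphic if there is an isomorphism of categories $G:\mathcal D_1\to\mathcal D_2$ with $G\circ F_1=F_2$. *)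

theory Defs
  imports Main
begin

section \<open>Categories and functors\<close>

record ('o, 'm) cat =
  Obj :: "'o set"
  Arr :: "'m set"
  Dom :: "'m \<Rightarrow> 'o"
  Cod :: "'m \<Rightarrow> 'o"
  Ident :: "'o \<Rightarrow> 'm"
  Comp :: "'m \<Rightarrow> 'm \<Rightarrow> 'm"

text \<open>\<open>Comp C g f\<close> is the composite \<open>g \<circ> f\<close>. All operations are total functions; they are only
  constrained on the carriers and, for \<open>Comp\<close>, on composable pairs.\<close>

locale category =
  fixes C :: "('o, 'm) cat"
  assumes Dom_in: "f \<in> Arr C \<Longrightarrow> Dom C f \<in> Obj C"
    and Cod_in: "f \<in> Arr C \<Longrightarrow> Cod C f \<in> Obj C"
    and Ident_in: "X \<in> Obj C \<Longrightarrow> Ident C X \<in> Arr C"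
    and Dom_Ident: "X \<in> Obj C \<Longrightarrow> Dom C (Ident C X) = X"
    and Cod_Ident: "X \<in> Obj C \<Longrightarrow> Cod C (Ident C X) = X"
    and Comp_in: "\<lbrakk>f \<in> Arr C; g \<in> Arr C; Cod C f = Dom C g\<rbrakk> \<Longrightarrow> Comp C g f \<in> Arr C"
    and Dom_Comp: "\<lbrakk>f \<in> Arr C; g \<in> Arr C; Cod C f = Dom C g\<rbrakk> \<Longrightarrow> Dom C (Comp C g f) = Dom C f"
    and Cod_Comp: "\<lbrakk>f \<in> Arr C; g \<in> Arr C; Cod C f = Dom C g\<rbrakk> \<Longrightarrow> Cod C (Comp C g f) = Cod C g"
    and Comp_Ident_right: "f \<in> Arr C \<Longrightarrow> Comp C f (Ident C (Dom C f)) = f"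
    and Comp_Ident_left: "f \<in> Arr C \<Longrightarrow> Comp C (Ident C (Cod C f)) f = f"
    and Comp_assoc: "\<lbrakk>f \<in> Arr C; g \<in> Arr C; h \<in> Arr C; Cod C f = Dom C g; Cod C g = Dom C h\<rbrakk>
      \<Longrightarrow> Comp C h (Comp C g f) = Comp C (Comp C h g) f"

record ('o, 'm, 'p, 'n) fctr =
  OMap :: "'o \<Rightarrow> 'p"
  AMap :: "'m \<Rightarrow> 'n"

locale is_functor = dom: category C + cod: category D
  for C :: "('o, 'm) cat" and D :: "('p, 'n) cat" +
  fixes F :: "('o, 'm, 'p, 'n) fctr"
  assumes OMap_in: "X \<in> Obj C \<Longrightarrow> OMap F X \<in> Obj D"
    and AMap_in: "f \<in> Arr C \<Longrightarrow> AMap F f \<in> Arr D"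
    and Dom_AMap: "f \<in> Arr C \<Longrightarrow> Dom D (AMap F f) = OMap F (Dom C f)"
    and Cod_AMap: "f \<in> Arr C \<Longrightarrow> Cod D (AMap F f) = OMap F (Cod C f)"
    and AMap_Ident: "X \<in> Obj C \<Longrightarrow> AMap F (Ident C X) = Ident D (OMap F X)"
    and AMap_Comp: "\<lbrakk>f \<in> Arr C; g \<in> Arr C; Cod C f = Dom C g\<rbrakk>
      \<Longrightarrow> AMap F (Comp C g f) = Comp D (AMap F g) (AMap F f)"

definition id_functor :: "('o, 'm, 'o, 'm) fctr" where
  "id_functor = \<lparr>OMap = id, AMap = id\<rparr>"

definition comp_functor ::
  "('p, 'n, 'q, 'l) fctr \<Rightarrow> ('o, 'm, 'p, 'n) fctr \<Rightarrow> ('o, 'm, 'q, 'l) fctr" where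
  "comp_functor G F = \<lparr>OMap = OMap G \<circ> OMap F, AMap = AMap G \<circ> AMap F\<rparr>"

text \<open>Equality of functors out of \<open>C\<close>: values outside the carriers of \<open>C\<close> are irrelevant.\<close>

definition functor_eq :: "('o, 'm) cat \<Rightarrow> ('o, 'm, 'p, 'n) fctr \<Rightarrow> ('o, 'm, 'p, 'n) fctr \<Rightarrow> bool" where
  "functor_eq C F G \<longleftrightarrow>
     (\<forall>X\<in>Obj C. OMap F X = OMap G X) \<and> (\<forall>f\<in>Arr C. AMap F f = AMap G f)"

definition identity_on_objects :: "('o, 'm) cat \<Rightarrow> ('o, 'n) cat \<Rightarrow> ('o, 'm, 'o, 'n) fctr \<Rightarrow> bool" where
  "identity_on_objects C D F \<longleftrightarrow> Obj D = Obj C \<and> (\<forall>X\<in>Obj C. OMap F X = X)"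

definition faithful :: "('o, 'm) cat \<Rightarrow> ('o, 'm, 'p, 'n) fctr \<Rightarrow> bool" where
  "faithful C F \<longleftrightarrow> (\<forall>f\<in>Arr C. \<forall>g\<in>Arr C.
     Dom C f = Dom C g \<and> Cod C f = Cod C g \<and> AMap F f = AMap F g \<longrightarrow> f = g)"

definition is_cat_iso :: "('o, 'm) cat \<Rightarrow> ('p, 'n) cat \<Rightarrow> ('o, 'm, 'p, 'n) fctr \<Rightarrow> bool" where
  "is_cat_iso C D G \<longleftrightarrow> is_functor C D G \<and>
     (\<exists>H. is_functor D C H \<and> functor_eq C (comp_functor H G) id_functor
        \<and> functor_eq D (comp_functor G H) id_functor)"

definition isomorphic_under :: "('o, 'm) cat
    \<Rightarrow> ('p, 'n) cat \<Rightarrow> ('o, 'm, 'p, 'n) fctr \<Rightarrow> ('q, 'l) cat \<Rightarrow> ('o, 'm, 'q, 'l) fctr \<Rightarrow> bool" where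
  "isomorphic_under C D1 F1 D2 F2 \<longleftrightarrow>
     (\<exists>G. is_cat_iso D1 D2 G \<and> functor_eq C (comp_functor G F1) F2)"


section \<open>Localization\<close>

text \<open>\<open>Fwd a\<close> is the line \<open>a : dom a \<rightarrow> cod a\<close>, and \<open>Bwd d\<close> is the formal inverse line
  \<open>l\<^sub>d : cod d \<rightarrow> dom d\<close>.\<close>

datatype 'm line = Fwd 'm | Bwd 'm

primrec is_line :: "('o, 'm) cat \<Rightarrow> 'm set \<Rightarrow> 'm line \<Rightarrow> bool" where
  "is_line C \<Sigma> (Fwd a) \<longleftrightarrow> a \<in> Arr C"
| "is_line C \<Sigma> (Bwd d) \<longleftrightarrow> d \<in> \<Sigma>"

primrec line_dom :: "('o, 'm) cat \<Rightarrow> 'm line \<Rightarrow> 'o" where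
  "line_dom C (Fwd a) = Dom C a"
| "line_dom C (Bwd d) = Cod C d"

primrec line_cod :: "('o, 'm) cat \<Rightarrow> 'm line \<Rightarrow> 'o" where
  "line_cod C (Fwd a) = Cod C a"
| "line_cod C (Bwd d) = Dom C d"

primrec is_path :: "('o, 'm) cat \<Rightarrow> 'm set \<Rightarrow> 'o \<Rightarrow> 'm line list \<Rightarrow> bool" where
  "is_path C \<Sigma> X [] \<longleftrightarrow> X \<in> Obj C"
| "is_path C \<Sigma> X (l # p) \<longleftrightarrow>
     X \<in> Obj C \<and> is_line C \<Sigma> l \<and> line_dom C l = X \<and> is_path C \<Sigma> (line_cod C l) p"

text \<open>A sequence is a pair of its starting object and its list of lines in order of traversal, so
  that the empty sequences are given by the objects.\<close>

type_synonym ('o, 'm) sqn = "'o \<times> 'm line list"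

definition sigma_seqs :: "('o, 'm) cat \<Rightarrow> 'm set \<Rightarrow> ('o, 'm) sqn set" where
  "sigma_seqs C \<Sigma> = {(X, p). is_path C \<Sigma> X p}"

definition seq_dom :: "('o, 'm) sqn \<Rightarrow> 'o" where
  "seq_dom s = fst s"

definition seq_cod :: "('o, 'm) cat \<Rightarrow> ('o, 'm) sqn \<Rightarrow> 'o" where
  "seq_cod C s = (if snd s = [] then fst s else line_cod C (last (snd s)))"

definition seq_append :: "('o, 'm) sqn \<Rightarrow> ('o, 'm) sqn \<Rightarrow> ('o, 'm) sqn" where
  "seq_append s t = (fst s, snd s @ snd t)"

inductive basic_step :: "('o, 'm) cat \<Rightarrow> 'm set \<Rightarrow> 'm line list \<Rightarrow> 'm line list \<Rightarrow> bool"
  for C \<Sigma> where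
  comp: "\<lbrakk>a \<in> Arr C; a' \<in> Arr C; Cod C a = Dom C a'\<rbrakk>
    \<Longrightarrow> basic_step C \<Sigma> [Fwd a, Fwd a'] [Fwd (Comp C a' a)]"
| bwd_fwd: "d \<in> \<Sigma> \<Longrightarrow> basic_step C \<Sigma> [Bwd d, Fwd d] []"
| fwd_bwd: "d \<in> \<Sigma> \<Longrightarrow> basic_step C \<Sigma> [Fwd d, Bwd d] []"
| ident: "X \<in> Obj C \<Longrightarrow> basic_step C \<Sigma> [Fwd (Ident C X)] []"

text \<open>Requiring both sides to be \<open>\<Sigma>\<close>-sequences ensures that, read backwards, a step inserts only
  loops based at the object reached so far.\<close>

inductive seq_step :: "('o, 'm) cat \<Rightarrow> 'm set \<Rightarrow> ('o, 'm) sqn \<Rightarrow> ('o, 'm) sqn \<Rightarrow> bool"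
  for C \<Sigma> where
  "\<lbrakk>basic_step C \<Sigma> u v; (X, p @ u @ q) \<in> sigma_seqs C \<Sigma>; (X, p @ v @ q) \<in> sigma_seqs C \<Sigma>\<rbrakk>
    \<Longrightarrow> seq_step C \<Sigma> (X, p @ u @ q) (X, p @ v @ q)"

definition seq_rel :: "('o, 'm) cat \<Rightarrow> 'm set \<Rightarrow> ('o, 'm) sqn rel" where
  "seq_rel C \<Sigma> = {(s, t). s \<in> sigma_seqs C \<Sigma> \<and> t \<in> sigma_seqs C \<Sigma> \<and> equivclp (seq_step C \<Sigma>) s t}"

definition seq_class :: "('o, 'm) cat \<Rightarrow> 'm set \<Rightarrow> ('o, 'm) sqn \<Rightarrow> ('o, 'm) sqn set" where
  "seq_class C \<Sigma> s = seq_rel C \<Sigma> `` {s}"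

text \<open>Equivalent sequences have the same domain and codomain, so \<open>the_elem\<close> below is applied to
  singletons, and the union defining the composite is over a constant family.\<close>

definition localization :: "('o, 'm) cat \<Rightarrow> 'm set \<Rightarrow> ('o, ('o, 'm) sqn set) cat" where
  "localization C \<Sigma> =
    \<lparr>Obj = Obj C,
     Arr = sigma_seqs C \<Sigma> // seq_rel C \<Sigma>,
     Dom = (\<lambda>c. the_elem (seq_dom ` c)),
     Cod = (\<lambda>c. the_elem (seq_cod C ` c)),
     Ident = (\<lambda>X. seq_class C \<Sigma> (X, [])),
     Comp = (\<lambda>c' c. \<Union>s\<in>c. \<Union>s'\<in>c'. seq_class C \<Sigma> (seq_append s s'))\<rparr>"

definition localization_functor ::
  "('o, 'm) cat \<Rightarrow> 'm set \<Rightarrow> ('o, 'm, 'o, ('o, 'm) sqn set) fctr" where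
  "localization_functor C \<Sigma> =
    \<lparr>OMap = (\<lambda>X. X), AMap = (\<lambda>a. seq_class C \<Sigma> (Dom C a, [Fwd a]))\<rparr>"


section \<open>Dilatations\<close>

definition sieve :: "('o, 'm) cat \<Rightarrow> 'm set \<Rightarrow> bool" where
  "sieve C N \<longleftrightarrow> N \<subseteq> Arr C \<and>
     (\<forall>n\<in>N. \<forall>f\<in>Arr C. Cod C f = Dom C n \<longrightarrow> Comp C n f \<in> N)"

definition sieve_over :: "('o, 'm) cat \<Rightarrow> 'o \<Rightarrow> 'm set \<Rightarrow> bool" where
  "sieve_over C Y N \<longleftrightarrow> sieve C N \<and> (\<forall>n\<in>N. Cod C n = Y)"

text \<open>A center is represented by the set of its pairs \<open>(N\<^sub>i, d\<^sub>i)\<close>. The same \<open>d\<close> may occur with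
  several sieves; repeating a pair in an indexed family would not change the fractions.\<close>

definition center :: "('o, 'm) cat \<Rightarrow> ('m set \<times> 'm) set \<Rightarrow> bool" where
  "center C K \<longleftrightarrow> (\<forall>(N, d)\<in>K. d \<in> Arr C \<and> sieve_over C (Cod C d) N)"

definition center_seqs :: "('o, 'm) cat \<Rightarrow> ('m set \<times> 'm) set \<Rightarrow> ('o, 'm) sqn set" where
  "center_seqs C K =
    {(X, concat (map (\<lambda>(n, d). [Fwd n, Bwd d]) nds) @ [Fwd a]) | X nds a.
       a \<in> Arr C \<and> (\<forall>(n, d)\<in>set nds. \<exists>N. (N, d) \<in> K \<and> n \<in> N)}
    \<inter> sigma_seqs C (snd ` K)"

definition dilatation :: "('o, 'm) cat \<Rightarrow> ('m set \<times> 'm) set \<Rightarrow> ('o, ('o, 'm) sqn set) cat" where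
  "dilatation C K = (localization C (snd ` K))
    \<lparr>Arr := {c \<in> Arr (localization C (snd ` K)). \<exists>s\<in>c. s \<in> center_seqs C K}\<rparr>"

text \<open>The canonical functor has the same formula as the localization functor, with another
  codomain.\<close>

definition canonical_functor ::
  "('o, 'm) cat \<Rightarrow> ('m set \<times> 'm) set \<Rightarrow> ('o, 'm, 'o, ('o, 'm) sqn set) fctr" where
  "canonical_functor C K =
    \<lparr>OMap = (\<lambda>X. X), AMap = (\<lambda>a. seq_class C (snd ` K) (Dom C a, [Fwd a]))\<rparr>"

end

theory Submission
  imports Defs
begin

text \<open>Let \<open>C\<close> be the span \<open>1 \<leftarrow> 0 \<rightarrow> 2\<close> with legs \<open>d\<close> and \<open>g\<close>, and let \<open>D\<close> be the subcategory of
  \<open>C[d\<inverse>]\<close> of all arrows \<open>X \<rightarrow> Y\<close> with \<open>X \<le> Y\<close>. It contains the arrow \<open>g \<circ> d\<inverse> : 1 \<rightarrow> 2\<close>, but no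
  arrow \<open>1 \<rightarrow> 0\<close>. In a dilatation every initial part of a fraction is again an arrow. Since \<open>C\<close> has
  no arrow out of \<open>1\<close> but the identity, a fraction from \<open>1\<close> to \<open>2\<close> has to leave \<open>1\<close> by inverting \<open>d\<close>,
  so a dilatation with an arrow \<open>1 \<rightarrow> 2\<close> also has an arrow \<open>1 \<rightarrow> 0\<close>.\<close>

section \<open>The localization is a category\<close>

lemma seq_dom_Pair [simp]: "seq_dom (X, p) = X"
  by (simp add: seq_dom_def)

lemma seq_cod_Nil [simp]: "seq_cod C (X, []) = X"
  by (simp add: seq_cod_def)

lemma seq_cod_Cons [simp]: "seq_cod C (X, l # p) = seq_cod C (line_cod C l, p)"
  by (simp add: seq_cod_def)

lemma seq_cod_append [simp]: "seq_cod C (X, p @ q) = seq_cod C (seq_cod C (X, p), q)"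
  by (induction p arbitrary: X) auto

lemma is_path_Obj: "is_path C \<Sigma> X p \<Longrightarrow> X \<in> Obj C"
  by (cases p) auto

lemma seq_cod_Obj: "is_path C \<Sigma> X p \<Longrightarrow> seq_cod C (X, p) \<in> Obj C"
  by (induction p arbitrary: X) auto

lemma is_path_append:
  "is_path C \<Sigma> X (p @ q) \<longleftrightarrow> is_path C \<Sigma> X p \<and> is_path C \<Sigma> (seq_cod C (X, p)) q"
  by (induction p arbitrary: X) (auto dest: is_path_Obj)

lemma seq_append_sigma:
  assumes "s \<in> sigma_seqs C \<Sigma>" "t \<in> sigma_seqs C \<Sigma>" "seq_cod C s = seq_dom t"
  shows "seq_append s t \<in> sigma_seqs C \<Sigma>"
  using assms by (cases s; cases t) (auto simp: sigma_seqs_def seq_append_def is_path_append)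

lemma seq_dom_append: "seq_dom (seq_append s t) = seq_dom s"
  by (simp add: seq_append_def seq_dom_def)

lemma seq_cod_seq_append:
  "seq_cod C s = seq_dom t \<Longrightarrow> seq_cod C (seq_append s t) = seq_cod C t"
  by (cases s; cases t) (auto simp: seq_append_def)

lemma seq_append_assoc: "seq_append (seq_append s t) u = seq_append s (seq_append t u)"
  by (simp add: seq_append_def)

section \<open>Compatibility of replacement steps with endpoints and concatenation\<close>

lemma seq_step_sigma:
  "seq_step C \<Sigma> s t \<Longrightarrow> s \<in> sigma_seqs C \<Sigma> \<and> t \<in> sigma_seqs C \<Sigma>"
  by (auto elim: seq_step.cases)

lemma seq_step_dom: "seq_step C \<Sigma> s t \<Longrightarrow> seq_dom s = seq_dom t"
  by (auto elim: seq_step.cases)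

text \<open>When a loop is deleted, the right-hand side ends at \<open>X\<close>, while the loop
  ends at an object read off from its lines; the path hypothesis identifies the two.\<close>

lemma (in category) basic_step_cod:
  "\<lbrakk>basic_step C \<Sigma> u v; is_path C \<Sigma> X u\<rbrakk> \<Longrightarrow> seq_cod C (X, u) = seq_cod C (X, v)"
  by (induction rule: basic_step.induct) (auto simp: Cod_Comp Cod_Ident Dom_Ident)

lemma (in category) seq_step_cod: "seq_step C \<Sigma> s t \<Longrightarrow> seq_cod C s = seq_cod C t"
  by (erule seq_step.cases) (auto simp: sigma_seqs_def is_path_append dest!: basic_step_cod)

lemma (in category) equiv_steps_dom_cod:
  "equivclp (seq_step C \<Sigma>) s t \<Longrightarrow> seq_dom s = seq_dom t \<and> seq_cod C s = seq_cod C t"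
  by (induction rule: equivclp_induct) (auto dest: seq_step_dom seq_step_cod)

text \<open>A replacement happens inside a context \<open>p\<close>, \<open>q\<close>, and
  \<open>t\<close> is absorbed into \<open>q\<close>. A step demands sequences on both sides, so the
  codomain of \<open>s'\<close> has to match \<open>t\<close> as well.\<close>

lemma (in category) seq_step_append_right:
  assumes "seq_step C \<Sigma> s s'" "t \<in> sigma_seqs C \<Sigma>" "seq_cod C s = seq_dom t"
  shows "seq_step C \<Sigma> (seq_append s t) (seq_append s' t)"
proof -
  have cod': "seq_cod C s' = seq_dom t"
    using assms seq_step_cod by metis
  obtain u v X p q where *: "basic_step C \<Sigma> u v" "s = (X, p @ u @ q)" "s' = (X, p @ v @ q)"
    using assms(1) by (auto elim: seq_step.cases)
  have "seq_append s t \<in> sigma_seqs C \<Sigma>" "seq_append s' t \<in> sigma_seqs C \<Sigma>"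
    using assms cod' seq_step_sigma by (metis seq_append_sigma)+
  then show ?thesis
    using seq_step.intros[OF *(1), of X p "q @ snd t"] by (simp add: *(2,3) seq_append_def)
qed

lemma seq_step_append_left:
  assumes "seq_step C \<Sigma> s s'" "t \<in> sigma_seqs C \<Sigma>" "seq_cod C t = seq_dom s"
  shows "seq_step C \<Sigma> (seq_append t s) (seq_append t s')"
proof -
  have dom': "seq_cod C t = seq_dom s'"
    using assms seq_step_dom by metis
  obtain u v X p q where *: "basic_step C \<Sigma> u v" "s = (X, p @ u @ q)" "s' = (X, p @ v @ q)"
    using assms(1) by (auto elim: seq_step.cases)
  have "seq_append t s \<in> sigma_seqs C \<Sigma>" "seq_append t s' \<in> sigma_seqs C \<Sigma>"
    using assms dom' seq_step_sigma by (metis seq_append_sigma)+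
  then show ?thesis
    using seq_step.intros[OF *(1), of "fst t" "snd t @ p" q] by (simp add: *(2,3) seq_append_def)
qed

lemma (in category) equiv_steps_append_right:
  assumes "equivclp (seq_step C \<Sigma>) s s'" "t \<in> sigma_seqs C \<Sigma>" "seq_cod C s = seq_dom t"
  shows "equivclp (seq_step C \<Sigma>) (seq_append s t) (seq_append s' t)"
  using assms(1)
proof (induction rule: equivclp_induct)
  case base
  show ?case by simp
next
  case (step y z)
  \<comment> \<open>The chain may traverse a step in either direction, so the endpoint condition is
    needed at both \<open>y\<close> and \<open>z\<close>.\<close>
  have "seq_cod C y = seq_dom t" "seq_cod C z = seq_dom t"
    using assms(3) step.hyps equiv_steps_dom_cod seq_step_cod by metis+
  with step.hyps(2) have "seq_step C \<Sigma> (seq_append y t) (seq_append z t) \<or>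
      seq_step C \<Sigma> (seq_append z t) (seq_append y t)"
    using seq_step_append_right assms(2) by blast
  with step.IH show ?case
    by (rule equivclp_into_equivclp)
qed

lemma (in category) equiv_steps_append_left:
  assumes "equivclp (seq_step C \<Sigma>) s s'" "t \<in> sigma_seqs C \<Sigma>" "seq_cod C t = seq_dom s"
  shows "equivclp (seq_step C \<Sigma>) (seq_append t s) (seq_append t s')"
  using assms(1)
proof (induction rule: equivclp_induct)
  case base
  show ?case by simp
next
  case (step y z)
  have "seq_cod C t = seq_dom y" "seq_cod C t = seq_dom z"
    using assms(3) step.hyps equiv_steps_dom_cod seq_step_dom by metis+
  with step.hyps(2) have "seq_step C \<Sigma> (seq_append t y) (seq_append t z) \<or>
      seq_step C \<Sigma> (seq_append t z) (seq_append t y)"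
    using seq_step_append_left assms(2) by blast
  with step.IH show ?case
    by (rule equivclp_into_equivclp)
qed

section \<open>Equivalence classes of sequences\<close>

lemma equiv_seq_rel: "equiv (sigma_seqs C \<Sigma>) (seq_rel C \<Sigma>)"
proof (rule equivI)
  show "seq_rel C \<Sigma> \<subseteq> sigma_seqs C \<Sigma> \<times> sigma_seqs C \<Sigma>"
    by (auto simp: seq_rel_def)
  show "refl_on (sigma_seqs C \<Sigma>) (seq_rel C \<Sigma>)"
    by (auto simp: refl_on_def seq_rel_def)
  show "sym (seq_rel C \<Sigma>)"
    by (auto simp: sym_def seq_rel_def intro: equivclp_sym)
  show "trans (seq_rel C \<Sigma>)"
    unfolding trans_def seq_rel_def by (blast intro: equivclp_trans)
qed

lemma mem_seq_class:
  "t \<in> seq_class C \<Sigma> s \<longleftrightarrow>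
     s \<in> sigma_seqs C \<Sigma> \<and> t \<in> sigma_seqs C \<Sigma> \<and> equivclp (seq_step C \<Sigma>) s t"
  by (simp add: seq_class_def seq_rel_def)

lemma seq_class_self: "s \<in> sigma_seqs C \<Sigma> \<Longrightarrow> s \<in> seq_class C \<Sigma> s"
  by (simp add: mem_seq_class)

lemma seq_class_eqI:
  assumes "equivclp (seq_step C \<Sigma>) s t" "s \<in> sigma_seqs C \<Sigma>" "t \<in> sigma_seqs C \<Sigma>"
  shows "seq_class C \<Sigma> s = seq_class C \<Sigma> t"
  unfolding seq_class_def
  by (rule equiv_class_eq[OF equiv_seq_rel]) (simp add: seq_rel_def assms)

lemma seq_class_Arr:
  "s \<in> sigma_seqs C \<Sigma> \<Longrightarrow> seq_class C \<Sigma> s \<in> Arr (localization C \<Sigma>)"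
  by (simp add: localization_def seq_class_def quotientI)

text \<open>Any member of an arrow may serve as its representative; this lets a fraction be studied
  through a member of the special form \<open>center_seqs\<close>.\<close>

lemma Arr_localization_eq_class:
  assumes "c \<in> Arr (localization C \<Sigma>)" "s \<in> c"
  shows "s \<in> sigma_seqs C \<Sigma>" "c = seq_class C \<Sigma> s"
proof -
  obtain t where t: "t \<in> sigma_seqs C \<Sigma>" "c = seq_class C \<Sigma> t"
    using assms(1) by (auto simp: localization_def seq_class_def elim: quotientE)
  with assms(2) show "s \<in> sigma_seqs C \<Sigma>" "c = seq_class C \<Sigma> s"
    using seq_class_eqI[of C \<Sigma> t s] by (auto simp: mem_seq_class)
qed

lemma Arr_localizationE:
  assumes "c \<in> Arr (localization C \<Sigma>)"
  obtains s where "s \<in> sigma_seqs C \<Sigma>" "c = seq_class C \<Sigma> s"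
  using assms by (auto simp: localization_def seq_class_def elim: quotientE)

context category
begin

section \<open>Endpoints and composites of classes, and the category laws\<close>

lemma Dom_seq_class:
  assumes "s \<in> sigma_seqs C \<Sigma>"
  shows "Dom (localization C \<Sigma>) (seq_class C \<Sigma> s) = seq_dom s"
proof -
  have "seq_dom ` seq_class C \<Sigma> s = {seq_dom s}"
    using seq_class_self[OF assms] by (force simp: mem_seq_class dest: equiv_steps_dom_cod)
  then show ?thesis by (simp add: localization_def)
qed

lemma Cod_seq_class:
  assumes "s \<in> sigma_seqs C \<Sigma>"
  shows "Cod (localization C \<Sigma>) (seq_class C \<Sigma> s) = seq_cod C s"
proof -
  have "seq_cod C ` seq_class C \<Sigma> s = {seq_cod C s}"
    using seq_class_self[OF assms] by (force simp: mem_seq_class dest: equiv_steps_dom_cod)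
  then show ?thesis by (simp add: localization_def)
qed

lemma seq_class_append_cong:
  assumes "s' \<in> seq_class C \<Sigma> s" "t' \<in> seq_class C \<Sigma> t" "seq_cod C s = seq_dom t"
  shows "seq_class C \<Sigma> (seq_append s' t') = seq_class C \<Sigma> (seq_append s t)"
proof -
  have *: "s \<in> sigma_seqs C \<Sigma>" "s' \<in> sigma_seqs C \<Sigma>" "equivclp (seq_step C \<Sigma>) s s'"
    "t \<in> sigma_seqs C \<Sigma>" "t' \<in> sigma_seqs C \<Sigma>" "equivclp (seq_step C \<Sigma>) t t'"
    using assms(1,2) by (auto simp: mem_seq_class)
  have **: "seq_cod C s' = seq_dom t'" "seq_cod C s' = seq_dom t"
    using *(3,6) assms(3) by (auto dest!: equiv_steps_dom_cod)
  \<comment> \<open>First \<open>s\<close> is exchanged for \<open>s'\<close> with \<open>t\<close>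
    fixed, then \<open>t\<close> for \<open>t'\<close> with \<open>s'\<close> fixed.\<close>
  have "equivclp (seq_step C \<Sigma>) (seq_append s t) (seq_append s' t')"
    using equiv_steps_append_right[OF *(3,4) assms(3)] equiv_steps_append_left[OF *(6,2) **(2)]
    by (rule equivclp_trans)
  then show ?thesis
    by (intro seq_class_eqI[symmetric] seq_append_sigma * ** assms(3))
qed

text \<open>By congruence all classes in the union defining the composite coincide, and both index
  sets are nonempty because \<open>s\<close> and \<open>t\<close> lie in their own classes; so the
  union collapses.\<close>

lemma Comp_seq_class:
  assumes "s \<in> sigma_seqs C \<Sigma>" "t \<in> sigma_seqs C \<Sigma>" "seq_cod C s = seq_dom t"
  shows "Comp (localization C \<Sigma>) (seq_class C \<Sigma> t) (seq_class C \<Sigma> s)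
    = seq_class C \<Sigma> (seq_append s t)"
proof -
  have "(\<Union>s'\<in>seq_class C \<Sigma> s. \<Union>t'\<in>seq_class C \<Sigma> t. seq_class C \<Sigma> (seq_append s' t'))
    = seq_class C \<Sigma> (seq_append s t)"
    using seq_class_append_cong[OF _ _ assms(3)] seq_class_self[OF assms(1)]
      seq_class_self[OF assms(2)] by blast
  then show ?thesis by (simp add: localization_def)
qed

text \<open>Once representatives are chosen, the unit and associativity laws reduce to those of list
  concatenation.\<close>

lemma category_localization: "category (localization C \<Sigma>)"
proof
  let ?L = "localization C \<Sigma>"
  have Obj_L: "Obj ?L = Obj C" and Ident_L: "Ident ?L X = seq_class C \<Sigma> (X, [])" for X
    by (simp_all add: localization_def)
  have empty: "(X, []) \<in> sigma_seqs C \<Sigma>" if "X \<in> Obj C" for X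
    using that by (simp add: sigma_seqs_def)
  have dom_Obj: "seq_dom s \<in> Obj C" and cod_Obj: "seq_cod C s \<in> Obj C"
    if "s \<in> sigma_seqs C \<Sigma>" for s
    using that by (auto simp: sigma_seqs_def is_path_Obj seq_cod_Obj)
  show "Dom ?L f \<in> Obj ?L" "Cod ?L f \<in> Obj ?L" if "f \<in> Arr ?L" for f
    using that by (auto simp only: Obj_L Dom_seq_class Cod_seq_class dom_Obj cod_Obj
        elim!: Arr_localizationE)
  show "Ident ?L X \<in> Arr ?L" "Dom ?L (Ident ?L X) = X" "Cod ?L (Ident ?L X) = X"
    if "X \<in> Obj ?L" for X
    using that by (auto simp: Obj_L Ident_L empty seq_class_Arr Dom_seq_class Cod_seq_class)
  fix f assume "f \<in> Arr ?L"
  then obtain s where s: "s \<in> sigma_seqs C \<Sigma>" and f: "f = seq_class C \<Sigma> s"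
    by (rule Arr_localizationE)
  show "Comp ?L f (Ident ?L (Dom ?L f)) = f"
    using s dom_Obj[OF s]
    by (simp add: f Dom_seq_class Ident_L Comp_seq_class empty) (simp add: seq_append_def seq_dom_def)
  show "Comp ?L (Ident ?L (Cod ?L f)) f = f"
    using s cod_Obj[OF s]
    by (simp add: f Cod_seq_class Ident_L Comp_seq_class empty) (simp add: seq_append_def)
  fix g assume "g \<in> Arr ?L" and fg: "Cod ?L f = Dom ?L g"
  then obtain t where t: "t \<in> sigma_seqs C \<Sigma>" and g: "g = seq_class C \<Sigma> t"
    by (blast elim: Arr_localizationE)
  have st: "seq_cod C s = seq_dom t"
    using fg s t by (simp add: f g Dom_seq_class Cod_seq_class)
  note app = seq_append_sigma[OF s t st]
  show "Comp ?L g f \<in> Arr ?L" "Dom ?L (Comp ?L g f) = Dom ?L f" "Cod ?L (Comp ?L g f) = Cod ?L g"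
    using s t st app by (simp_all add: f g Comp_seq_class seq_class_Arr Dom_seq_class Cod_seq_class
        seq_dom_append seq_cod_seq_append)
  fix h assume "h \<in> Arr ?L" and gh: "Cod ?L g = Dom ?L h"
  then obtain u where u: "u \<in> sigma_seqs C \<Sigma>" and h: "h = seq_class C \<Sigma> u"
    by (blast elim: Arr_localizationE)
  have tu: "seq_cod C t = seq_dom u"
    using gh t u by (simp add: g h Dom_seq_class Cod_seq_class)
  show "Comp ?L h (Comp ?L g f) = Comp ?L (Comp ?L h g) f"
    using s t u st tu app seq_append_sigma[OF t u tu]
    by (simp add: f g h Comp_seq_class seq_dom_append seq_cod_seq_append seq_append_assoc)
qed

section \<open>The localization functor\<close>

lemma single_sigma: "a \<in> Arr C \<Longrightarrow> (Dom C a, [Fwd a]) \<in> sigma_seqs C \<Sigma>"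
  by (simp add: sigma_seqs_def Dom_in Cod_in)

text \<open>Preservation of identities and of composites each amounts to a single replacement,
  \<open>ident\<close> or \<open>comp\<close>, in the empty context.\<close>

lemma localization_functor_is_functor:
  "is_functor C (localization C \<Sigma>) (localization_functor C \<Sigma>)"
proof -
  let ?L = "localization C \<Sigma>"
  interpret L: category ?L by (rule category_localization)
  show ?thesis
  proof
    show "OMap (localization_functor C \<Sigma>) X \<in> Obj ?L" if "X \<in> Obj C" for X
      using that by (simp add: localization_def localization_functor_def)
    show "AMap (localization_functor C \<Sigma>) f \<in> Arr ?L"
      "Dom ?L (AMap (localization_functor C \<Sigma>) f) = OMap (localization_functor C \<Sigma>) (Dom C f)"
      "Cod ?L (AMap (localization_functor C \<Sigma>) f) = OMap (localization_functor C \<Sigma>) (Cod C f)"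
      if "f \<in> Arr C" for f
      using single_sigma[OF that, of \<Sigma>]
      by (simp_all add: localization_functor_def seq_class_Arr Dom_seq_class Cod_seq_class)
    show "AMap (localization_functor C \<Sigma>) (Ident C X) = Ident ?L (OMap (localization_functor C \<Sigma>) X)"
      if X: "X \<in> Obj C" for X
    proof -
      have *: "(X, [Fwd (Ident C X)]) \<in> sigma_seqs C \<Sigma>" "(X, []) \<in> sigma_seqs C \<Sigma>"
        using single_sigma[OF Ident_in[OF X]] X by (simp_all add: Dom_Ident sigma_seqs_def)
      then have "seq_step C \<Sigma> (X, [Fwd (Ident C X)]) (X, [])"
        using seq_step.intros[OF basic_step.ident[OF X], where p = "[]" and q = "[]"] by simp
      then show ?thesis
        using seq_class_eqI[OF r_into_equivclp *]
        by (simp add: localization_functor_def localization_def X Dom_Ident)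
    qed
    show "AMap (localization_functor C \<Sigma>) (Comp C g f)
        = Comp ?L (AMap (localization_functor C \<Sigma>) g) (AMap (localization_functor C \<Sigma>) f)"
      if fg: "f \<in> Arr C" "g \<in> Arr C" "Cod C f = Dom C g" for f g
    proof -
      have app: "seq_append (Dom C f, [Fwd f]) (Dom C g, [Fwd g]) = (Dom C f, [Fwd f, Fwd g])"
        by (simp add: seq_append_def)
      have *: "(Dom C f, [Fwd f, Fwd g]) \<in> sigma_seqs C \<Sigma>"
        "(Dom C f, [Fwd (Comp C g f)]) \<in> sigma_seqs C \<Sigma>"
        using fg by (simp_all add: sigma_seqs_def Dom_in Cod_in Comp_in Dom_Comp Cod_Comp)
      then have "seq_step C \<Sigma> (Dom C f, [Fwd f, Fwd g]) (Dom C f, [Fwd (Comp C g f)])"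
        using seq_step.intros[OF basic_step.comp[OF fg], where p = "[]" and q = "[]"] by simp
      then show ?thesis
        using seq_class_eqI[OF r_into_equivclp *] fg
        by (simp add: localization_functor_def Dom_Comp Comp_seq_class single_sigma app)
    qed
  qed
qed

end


section \<open>Subcategories cut out by a preorder on the objects\<close>

text \<open>Each hom-set is either kept whole or dropped, depending only on its endpoints.
  Reflexivity keeps the identities and transitivity the composites.\<close>

definition monotone_part :: "('o::preorder, 'm) cat \<Rightarrow> ('o, 'm) cat" where
  "monotone_part C = C\<lparr>Arr := {f \<in> Arr C. Dom C f \<le> Cod C f}\<rparr>"

lemma category_monotone_part:
  assumes "category C"
  shows "category (monotone_part C)"
proof -
  interpret category C by fact
  show ?thesis
    by unfold_locales (auto simp: monotone_part_def Dom_in Cod_in Ident_in Dom_Ident Cod_Ident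
        Comp_in Dom_Comp Cod_Comp Comp_Ident_right Comp_Ident_left Comp_assoc intro: order_trans)
qed

lemma monotone_part_inclusion:
  assumes "category C"
  shows "is_functor (monotone_part C) C id_functor" "faithful (monotone_part C) id_functor"
proof -
  interpret category C by fact
  interpret M: category "monotone_part C" by (rule category_monotone_part) fact
  show "is_functor (monotone_part C) C id_functor"
    by unfold_locales (auto simp: monotone_part_def id_functor_def)
  show "faithful (monotone_part C) id_functor"
    by (simp add: faithful_def id_functor_def)
qed

text \<open>The endpoints of an image arrow are the images of the endpoints, so landing in the
  subcategory is a condition on objects alone.\<close>

lemma functor_into_monotone_part:
  assumes "is_functor C D F" and "\<And>f. f \<in> Arr C \<Longrightarrow> OMap F (Dom C f) \<le> OMap F (Cod C f)"
  shows "is_functor C (monotone_part D) F"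
proof -
  interpret is_functor C D F by fact
  interpret M: category "monotone_part D" by (rule category_monotone_part) unfold_locales
  show ?thesis
    by unfold_locales (use assms(2) in \<open>auto simp: monotone_part_def OMap_in AMap_in Dom_AMap
        Cod_AMap AMap_Ident AMap_Comp\<close>)
qed


section \<open>The span\<close>

text \<open>The arrows 0, 1, 2 are the identities; the legs are \<open>3 : 0 \<rightarrow> 1\<close> and \<open>4 : 0 \<rightarrow> 2\<close>.\<close>

definition span_cat :: "(nat, nat) cat" where
  "span_cat = \<lparr>Obj = {0, 1, 2}, Arr = {0, 1, 2, 3, 4},
     Dom = (\<lambda>f. if f \<le> 2 then f else 0), Cod = (\<lambda>f. if f \<le> 2 then f else f - 2),
     Ident = (\<lambda>X. X), Comp = (\<lambda>g f. if g \<le> 2 then f else g)\<rparr>"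

text \<open>A leg starts at 0, and the only arrow ending at 0 is its identity; so a composite with a
  leg as outer factor is that leg, as the formula for \<open>Comp\<close> says.\<close>

lemma category_span_cat: "category span_cat"
  by unfold_locales (auto simp: span_cat_def)

interpretation span: category span_cat
  by (rule category_span_cat)

section \<open>Arrows out of 1 in a dilatation of the span\<close>

lemma dilatation_ArrI:
  assumes "s \<in> center_seqs C K"
  shows "seq_class C (snd ` K) s \<in> Arr (dilatation C K)"
proof -
  have "s \<in> sigma_seqs C (snd ` K)"
    using assms by (auto simp: center_seqs_def)
  then show ?thesis
    using assms seq_class_Arr seq_class_self by (fastforce simp: dilatation_def)
qed

lemma Dom_Cod_dilatation:
  "Dom (dilatation C K) = Dom (localization C (snd ` K))"
  "Cod (dilatation C K) = Cod (localization C (snd ` K))"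
  by (simp_all add: dilatation_def)

text \<open>Induction on the pairs: from 1 only the identity can be traversed, so the next inverted
  \<open>d\<close> ends at 1. It is the leg 3 or the identity 1, and inverting the leg would yield
  an excluded arrow from 1 to 0.\<close>

lemma span_fraction_stays:
  assumes "\<forall>(n, d)\<in>set nds. \<exists>N. (N, d) \<in> K \<and> n \<in> N" and "snd ` K \<subseteq> Arr span_cat"
    and "\<nexists>c. c \<in> Arr (dilatation span_cat K) \<and> Dom (dilatation span_cat K) c = 1
        \<and> Cod (dilatation span_cat K) c = 0"
    and "is_path span_cat (snd ` K) 1 (concat (map (\<lambda>(n, d). [Fwd n, Bwd d]) nds))"
  shows "seq_cod span_cat (1, concat (map (\<lambda>(n, d). [Fwd n, Bwd d]) nds)) = 1"
  using assms(1,4)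
proof (induction nds)
  case Nil
  show ?case by simp
next
  case (Cons nd nds)
  obtain n d where nd: "nd = (n, d)" by fastforce
  have path: "n \<in> Arr span_cat" "Dom span_cat n = 1" "Cod span_cat d = Cod span_cat n"
    "d \<in> snd ` K"
    "is_path span_cat (snd ` K) (Dom span_cat d) (concat (map (\<lambda>(n, d). [Fwd n, Bwd d]) nds))"
    using Cons.prems(2) by (auto simp: nd)
  have n: "n = 1"
    using path(1,2) by (auto simp: span_cat_def split: if_splits)
  have "Dom span_cat d \<noteq> 0"
  proof
    assume d0: "Dom span_cat d = 0"
    \<comment> \<open>The initial part of the fraction, cut off after \<open>Bwd d\<close>. The
      closing \<open>Fwd 0\<close> is the identity of 0, supplying the final arrow that
      \<open>center_seqs\<close> requires.\<close>
    let ?s = "(1, [Fwd n, Bwd d, Fwd 0])"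
    have sigma: "?s \<in> sigma_seqs span_cat (snd ` K)"
      using path(1-4) d0 by (auto simp: sigma_seqs_def) (auto simp: span_cat_def)
    have "?s = (1, concat (map (\<lambda>(n, d). [Fwd n, Bwd d]) [(n, d)]) @ [Fwd 0])"
      by simp
    moreover have "0 \<in> Arr span_cat" "\<forall>(n, d)\<in>set [(n, d)]. \<exists>N. (N, d) \<in> K \<and> n \<in> N"
      using Cons.prems(1) by (auto simp: nd span_cat_def)
    ultimately have "?s \<in> center_seqs span_cat K"
      unfolding center_seqs_def using sigma by blast
    then have "seq_class span_cat (snd ` K) ?s \<in> Arr (dilatation span_cat K)"
      by (rule dilatation_ArrI)
    moreover have "seq_cod span_cat ?s = 0"
      by (simp add: span_cat_def)
    ultimately show False
      using assms(3) sigma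
      by (metis Dom_Cod_dilatation seq_dom_Pair span.Cod_seq_class span.Dom_seq_class)
  qed
  moreover have "d \<in> Arr span_cat"
    using path(4) assms(2) by blast
  \<comment> \<open>The remaining case is the identity at 1, which a center may also invert; the
    path then does not move.\<close>
  ultimately have "Dom span_cat d = 1"
    using path(3) by (auto simp: n span_cat_def split: if_splits)
  then show ?case
    using Cons.IH Cons.prems(1) path(5) by (simp add: nd)
qed

lemma span_dilatation_arrow:
  assumes "center span_cat K" and c: "c \<in> Arr (dilatation span_cat K)"
    "Dom (dilatation span_cat K) c = 1" "Cod (dilatation span_cat K) c = 2"
  obtains b where "b \<in> Arr (dilatation span_cat K)" "Dom (dilatation span_cat K) b = 1"
    "Cod (dilatation span_cat K) b = 0"
proof (rule ccontr)
  assume "\<not> thesis"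
  with that have none: "\<nexists>b. b \<in> Arr (dilatation span_cat K) \<and>
      Dom (dilatation span_cat K) b = 1 \<and> Cod (dilatation span_cat K) b = 0"
    by blast
  have K: "snd ` K \<subseteq> Arr span_cat"
    using assms(1) by (auto simp: center_def)
  have cL: "c \<in> Arr (localization span_cat (snd ` K))"
    and "\<exists>s\<in>c. s \<in> center_seqs span_cat K"
    using c(1) by (auto simp: dilatation_def)
  then obtain s where s: "s \<in> c" "s \<in> center_seqs span_cat K"
    by blast
  note cls = Arr_localization_eq_class[OF cL s(1)]
  have dc: "seq_dom s = 1" "seq_cod span_cat s = 2"
    using c(2,3) cls by (simp_all add: Dom_Cod_dilatation span.Dom_seq_class span.Cod_seq_class)
  obtain nds a where nds: "s = (1, concat (map (\<lambda>(n, d). [Fwd n, Bwd d]) nds) @ [Fwd a])"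
    "\<forall>(n, d)\<in>set nds. \<exists>N. (N, d) \<in> K \<and> n \<in> N" "a \<in> Arr span_cat"
    using s(2) dc(1) by (auto simp: center_seqs_def)
  have path: "is_path span_cat (snd ` K) 1 (concat (map (\<lambda>(n, d). [Fwd n, Bwd d]) nds))"
    "Dom span_cat a = seq_cod span_cat (1, concat (map (\<lambda>(n, d). [Fwd n, Bwd d]) nds))"
    using cls(1) by (auto simp: nds(1) sigma_seqs_def is_path_append)
  \<comment> \<open>All inverted pairs lead back to 1, so the final arrow \<open>a\<close> would be
    an arrow of the span from 1 to 2, and there is none.\<close>
  have "Dom span_cat a = 1"
    using path(2) span_fraction_stays[OF nds(2) K none path(1)] by simp
  moreover have "Cod span_cat a = 2"
    using dc(2) by (simp add: nds(1))
  ultimately show False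
    using nds(3) by (auto simp: span_cat_def split: if_splits)
qed

text \<open>Compatibility with the functors out of \<open>C\<close> forces the isomorphism and its
  inverse to fix every object of \<open>C\<close>, so they carry arrows from \<open>X\<close> to
  \<open>Y\<close> to arrows with the same endpoints, in both directions.\<close>

lemma isomorphic_under_arrow_iff:
  assumes "isomorphic_under C D1 F1 D2 F2"
    and "identity_on_objects C D1 F1" "\<forall>X\<in>Obj C. OMap F2 X = X"
    and "X \<in> Obj C" "Y \<in> Obj C"
  shows "(\<exists>f\<in>Arr D1. Dom D1 f = X \<and> Cod D1 f = Y) \<longleftrightarrow> (\<exists>f\<in>Arr D2. Dom D2 f = X \<and> Cod D2 f = Y)"
proof -
  obtain G H where "is_functor D1 D2 G" "is_functor D2 D1 H"
    and GF: "functor_eq C (comp_functor G F1) F2"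
    and HG: "functor_eq D1 (comp_functor H G) id_functor"
    using assms(1) by (auto simp: isomorphic_under_def is_cat_iso_def)
  interpret G: is_functor D1 D2 G by fact
  interpret H: is_functor D2 D1 H by fact
  have G_id: "OMap G Z = Z" if "Z \<in> Obj C" for Z
    using GF assms(2,3) that by (simp add: functor_eq_def comp_functor_def identity_on_objects_def)
  \<comment> \<open>\<open>Z\<close> equals its image under \<open>G\<close>, and \<open>H\<close>
    undoes \<open>G\<close>.\<close>
  have H_id: "OMap H Z = Z" if "Z \<in> Obj C" for Z
    using HG G_id[OF that] assms(2) that
    by (auto simp: functor_eq_def comp_functor_def id_functor_def identity_on_objects_def)
  show ?thesis
    using G.AMap_in G.Dom_AMap G.Cod_AMap H.AMap_in H.Dom_AMap H.Cod_AMap G_id H_id assms(4,5)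
    by metis
qed

section \<open>Assembling the counterexample\<close>

theorem fact5p2:
  shows "\<exists>(C :: (nat, nat) cat) (\<Gamma> :: nat set)
           (D :: (nat, (nat, nat) sqn set) cat)
           (F :: (nat, nat, nat, (nat, nat) sqn set) fctr)
           (G :: (nat, (nat, nat) sqn set, nat, (nat, nat) sqn set) fctr).
      category C \<and> \<Gamma> \<subseteq> Arr C
    \<and> is_functor C D F \<and> identity_on_objects C D F
    \<and> is_functor D (localization C \<Gamma>) G \<and> faithful D G
    \<and> functor_eq C (comp_functor G F) (localization_functor C \<Gamma>)
    \<and> (\<forall>K. center C K \<longrightarrow>
          \<not> isomorphic_under C D F (dilatation C K) (canonical_functor C K))"
proof -
  \<comment> \<open>Only the leg \<open>3\<close> from 0 to 1 is inverted.\<close>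
  let ?C = span_cat and ?\<Gamma> = "{3}"
  let ?L = "localization ?C ?\<Gamma>" and ?F = "localization_functor ?C ?\<Gamma>"
  let ?D = "monotone_part ?L"
  have sub: "?\<Gamma> \<subseteq> Arr ?C"
    by (simp add: span_cat_def)
  \<comment> \<open>No arrow of the span lowers the index of the object, so the localization functor
    factors through \<open>?D\<close>.\<close>
  have F: "is_functor ?C ?D ?F"
    by (rule functor_into_monotone_part[OF span.localization_functor_is_functor])
      (auto simp: localization_functor_def span_cat_def)
  have F_obj: "identity_on_objects ?C ?D ?F"
    by (simp add: identity_on_objects_def monotone_part_def localization_def
        localization_functor_def)
  \<comment> \<open>The witness for the faithful functor is the inclusion of \<open>?D\<close>,
    which is \<open>id_functor\<close>.\<close>
  have eq: "functor_eq ?C (comp_functor id_functor ?F) ?F"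
    by (simp add: functor_eq_def comp_functor_def id_functor_def)
  have "\<not> isomorphic_under ?C ?D ?F (dilatation ?C K) (canonical_functor ?C K)"
    if K: "center ?C K" for K
  proof
    assume iso: "isomorphic_under ?C ?D ?F (dilatation ?C K) (canonical_functor ?C K)"
    have can: "\<forall>X\<in>Obj ?C. OMap (canonical_functor ?C K) X = X"
      by (simp add: canonical_functor_def)
    have Obj: "0 \<in> Obj ?C" "1 \<in> Obj ?C" "2 \<in> Obj ?C"
      by (simp_all add: span_cat_def)
    note arrows = isomorphic_under_arrow_iff[OF iso F_obj can]
    \<comment> \<open>The fraction that goes back along leg 3 and then along leg 4; its class
      survives in \<open>?D\<close> since 1 \<le> 2.\<close>
    let ?s = "(1, [Bwd 3, Fwd 4])"
    have s: "?s \<in> sigma_seqs ?C ?\<Gamma>" "seq_cod ?C ?s = 2"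
      by (simp_all add: sigma_seqs_def span_cat_def)
    have "\<exists>f\<in>Arr ?D. Dom ?D f = 1 \<and> Cod ?D f = 2"
      using s by (intro bexI[of _ "seq_class ?C ?\<Gamma> ?s"])
        (simp_all add: monotone_part_def seq_class_Arr span.Dom_seq_class span.Cod_seq_class)
    then obtain c where "c \<in> Arr (dilatation ?C K)" "Dom (dilatation ?C K) c = 1"
        "Cod (dilatation ?C K) c = 2"
      using arrows[OF Obj(2,3)] by blast
    then obtain b where "b \<in> Arr (dilatation ?C K)" "Dom (dilatation ?C K) b = 1"
        "Cod (dilatation ?C K) b = 0"
      by (rule span_dilatation_arrow[OF K])
    then have "\<exists>f\<in>Arr ?D. Dom ?D f = 1 \<and> Cod ?D f = 0"
      using arrows[OF Obj(2,1)] by blast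
    then show False
      by (auto simp: monotone_part_def)
  qed
  then show ?thesis
    using category_span_cat sub F F_obj monotone_part_inclusion[OF span.category_localization] eq
    by blast
qed

end
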